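(* Let $n\geq 1$ and $d\geq 2$ be integers, let $f=x_0^d+x_1^d+\cdots+x_n^d\in\mathbb{C}[x_0,x_1,\ldots,x_n]$, and let $M(f)$ be its graded Milnor algebra. Put $T=(n+1)(d-2)$ and $F(t)=(1+t+t^2+\cdots+t^{d-2})^{n+1}$. Write the Hilbert-Poincaré series of $M(f)$ as $HP(M(f))(t)=\sum_{k\geq 0}a_k t^k$. Then $HP(M(f))(t)=F(t)$, which is a polynomial of degree $T$. In addition: (a) for $k=0,\ldots,d-2$, one has $a_k=\binom{n+k}{n}$; (b) for $k\geq d-1$, one has $$a_k=\binom{n+k}{n}+\sum_{m=1}^{q}(-1)^m\binom{n+1}{m}\binom{n+k-m(d-1)}{n},\qquad\text{where } q=\left\lfloor \frac{k}{d-1}\right\rfloor .$$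
   Context: Let $S=\mathbb{C}[x_0,\ldots,x_n]$ with its standard grading. For a homogeneous polynomial $f\in S$, the Jacobian ideal $J_f\subset S$ is the ideal generated by the partial derivatives $\partial f/\partial x_0,\ldots,\partial f/\partial x_n$, and the graded Milnor (or Jacobian) algebra is $M(f)=S/J_f$, with homogeneous components $M(f)_k$. The Hilbert-Poincaré series of a finitely generated graded $S$-module $M$ is $HP(M)(t)=\sum_{k\geq 0}(\dim_{\mathbb{C}}M_k)\,t^k$; thus $a_k=\dim_{\mathbb{C}}M(f)_k$. *)

theory Defs
  imports
    "HOL-Algebra.Embedded_Algebras"
    "HOL-Algebra.QuotRing"
    "HOL-Library.Poly_Mapping"
    "HOL-Computational_Algebra.Polynomial_FPS"
begin

text \<open>
  A monomial is a finitely supported map from variable indices to exponents, and a polynomial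
  over the complex numbers is a finitely supported map from monomials to coefficients; the type
  class instances of \<^typ>\<open>'a \<Rightarrow>\<^sub>0 'b\<close> provide the polynomial product (convolution).
\<close>

type_synonym monomial = "nat \<Rightarrow>\<^sub>0 nat"
type_synonym cpoly = "monomial \<Rightarrow>\<^sub>0 complex"

definition Const :: "complex \<Rightarrow> cpoly" where
  "Const c = Poly_Mapping.single 0 c"

definition Var :: "nat \<Rightarrow> cpoly" where
  "Var i = Poly_Mapping.single (Poly_Mapping.single i 1) 1"

text \<open>The ring $S = \mathbb{C}[x_0,\ldots,x_n]$, with $n + 1$ variables.\<close>

definition poly_ring :: "nat \<Rightarrow> cpoly ring" where
  "poly_ring n =
     \<lparr>carrier = {p. \<forall>m \<in> Poly_Mapping.keys p. Poly_Mapping.keys m \<subseteq> {..n}},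
      monoid.mult = (*), one = 1, zero = 0, add = (+)\<rparr>"

definition total_degree :: "monomial \<Rightarrow> nat" where
  "total_degree m = (\<Sum>i \<in> Poly_Mapping.keys m. Poly_Mapping.lookup m i)"

definition homogeneous_part :: "nat \<Rightarrow> nat \<Rightarrow> cpoly set" where
  "homogeneous_part n k =
     {p \<in> carrier (poly_ring n). \<forall>m \<in> Poly_Mapping.keys p. total_degree m = k}"

text \<open>
  Monomials not involving $x_i$ contribute 0, because their coefficient is multiplied by the
  exponent 0; the truncated subtraction of exponents is harmless there.
\<close>

definition partial_deriv :: "nat \<Rightarrow> cpoly \<Rightarrow> cpoly" where
  "partial_deriv i p =
     (\<Sum>m \<in> Poly_Mapping.keys p.
        Poly_Mapping.single (m - Poly_Mapping.single i 1)
          (of_nat (Poly_Mapping.lookup m i) * Poly_Mapping.lookup p m))"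

definition jacobian_ideal :: "nat \<Rightarrow> cpoly \<Rightarrow> cpoly set" where
  "jacobian_ideal n f = Idl\<^bsub>poly_ring n\<^esub> ((\<lambda>i. partial_deriv i f) ` {..n})"

definition milnor_algebra :: "nat \<Rightarrow> cpoly \<Rightarrow> cpoly set ring" where
  "milnor_algebra n f = poly_ring n Quot jacobian_ideal n f"

definition milnor_class :: "nat \<Rightarrow> cpoly \<Rightarrow> cpoly \<Rightarrow> cpoly set" where
  "milnor_class n f p = jacobian_ideal n f +>\<^bsub>poly_ring n\<^esub> p"

definition milnor_component :: "nat \<Rightarrow> cpoly \<Rightarrow> nat \<Rightarrow> cpoly set set" where
  "milnor_component n f k = milnor_class n f ` homogeneous_part n k"

text \<open>
  The library measures dimension over a subfield of the ring at hand, so the scalars are the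
  classes of the constants; they act on $M(f)$ by multiplication exactly as $\mathbb{C}$ does.
\<close>

definition milnor_scalars :: "nat \<Rightarrow> cpoly \<Rightarrow> cpoly set set" where
  "milnor_scalars n f = range (\<lambda>c. milnor_class n f (Const c))"

definition milnor_HP :: "nat \<Rightarrow> cpoly \<Rightarrow> int fps" where
  "milnor_HP n f =
     Abs_fps (\<lambda>k. int ((ring.dim (milnor_algebra n f) over milnor_scalars n f)
                         (milnor_component n f k)))"

text \<open>
  \<^const>\<open>ring.dim\<close> and the coset operations have their intended meaning only in rings, which is
  what the following facts guarantee.
\<close>

lemma cring_poly_ring: "cring (poly_ring n)"
proof -
  have add_closed: "p + q \<in> carrier (poly_ring n)"
    if "p \<in> carrier (poly_ring n)" "q \<in> carrier (poly_ring n)" for p q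
    using that Poly_Mapping.keys_add[of p q] unfolding poly_ring_def partial_object.simps by blast
  have mult_closed: "p * q \<in> carrier (poly_ring n)"
    if p: "p \<in> carrier (poly_ring n)" and q: "q \<in> carrier (poly_ring n)" for p q
  proof -
    have "Poly_Mapping.keys m \<subseteq> {..n}" if m: "m \<in> Poly_Mapping.keys (p * q)" for m
    proof -
      obtain a b where ab: "m = a + b" "a \<in> Poly_Mapping.keys p" "b \<in> Poly_Mapping.keys q"
        using subsetD[OF keys_mult m] by blast
      then have "Poly_Mapping.keys a \<subseteq> {..n}" "Poly_Mapping.keys b \<subseteq> {..n}"
        using p q unfolding poly_ring_def partial_object.simps by blast+
      then show ?thesis using Poly_Mapping.keys_add[of a b] ab(1) by blast
    qed
    then show ?thesis unfolding poly_ring_def by simp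
  qed
  have const: "0 \<in> carrier (poly_ring n)" "1 \<in> carrier (poly_ring n)"
    unfolding poly_ring_def by auto
  have uminus: "- p \<in> carrier (poly_ring n)" if "p \<in> carrier (poly_ring n)" for p
    using that unfolding poly_ring_def by simp
  have ops: "p \<oplus>\<^bsub>poly_ring n\<^esub> q = p + q" "p \<otimes>\<^bsub>poly_ring n\<^esub> q = p * q"
    "\<zero>\<^bsub>poly_ring n\<^esub> = 0" "\<one>\<^bsub>poly_ring n\<^esub> = 1" for p q
    unfolding poly_ring_def by simp_all
  show ?thesis
  proof (rule cringI)
    show "abelian_group (poly_ring n)"
    proof (rule abelian_groupI, unfold ops)
      fix p assume "p \<in> carrier (poly_ring n)"
      then show "\<exists>q \<in> carrier (poly_ring n). q + p = 0"
        by (intro bexI[of _ "- p"] uminus) simp_all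
    qed (simp_all add: add_closed const ac_simps)
    show "Group.comm_monoid (poly_ring n)"
      by (rule comm_monoidI, unfold ops) (simp_all add: mult_closed const ac_simps)
  qed (simp add: ops distrib_right)
qed

lemma partial_deriv_closed:
  assumes "f \<in> carrier (poly_ring n)"
  shows "partial_deriv i f \<in> carrier (poly_ring n)"
proof -
  have "Poly_Mapping.keys m \<subseteq> {..n}" if m: "m \<in> Poly_Mapping.keys (partial_deriv i f)" for m
  proof -
    obtain l where l: "l \<in> Poly_Mapping.keys f"
      and m_in: "m \<in> Poly_Mapping.keys (Poly_Mapping.single (l - Poly_Mapping.single i 1)
               (of_nat (Poly_Mapping.lookup l i) * Poly_Mapping.lookup f l))"
      using subsetD[OF Poly_Mapping.keys_sum m[unfolded partial_deriv_def]] by (rule UN_E)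
    from m_in have "m = l - Poly_Mapping.single i 1"
      by (simp only: keys_single split: if_splits) simp_all
    then have "Poly_Mapping.keys m \<subseteq> Poly_Mapping.keys l"
      by (simp add: subset_iff in_keys_iff lookup_minus)
    also have "\<dots> \<subseteq> {..n}"
      using l assms unfolding poly_ring_def by simp
    finally show ?thesis .
  qed
  then show ?thesis unfolding poly_ring_def by simp
qed

lemma ideal_jacobian_ideal:
  assumes "f \<in> carrier (poly_ring n)"
  shows "ideal (jacobian_ideal n f) (poly_ring n)"
  unfolding jacobian_ideal_def
proof (rule ring.genideal_ideal[OF cring.axioms(1)[OF cring_poly_ring]])
  show "(\<lambda>i. partial_deriv i f) ` {..n} \<subseteq> carrier (poly_ring n)"
    using partial_deriv_closed[OF assms] by (rule image_subsetI)
qed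

lemma cring_milnor_algebra:
  assumes "f \<in> carrier (poly_ring n)"
  shows "cring (milnor_algebra n f)"
  unfolding milnor_algebra_def
  using ideal.quotient_is_cring[OF ideal_jacobian_ideal[OF assms] cring_poly_ring] .

end

theory Submission
  imports Defs
begin

text \<open>
  The partial derivatives of the Fermat polynomial are $d\, x_i^{d-1}$, so the Jacobian ideal is
  spanned by the monomials having some exponent at least $d - 1$, and the remaining monomials of
  degree $k$ give a basis of $M(f)_k$. Expanding the product shows that their number is the
  coefficient of $t^k$ in $(1 + t + \cdots + t^{d-2})^{n+1} = (1 - t^{d-1})^{n+1} / (1 - t)^{n+1}$,
  and the binomial theorem together with
  $1/(1-t)^{n+1} = \sum_k \binom{n+k}{n} t^k$ yields the closed formulas.
\<close>

section \<open>Powers of truncated geometric series\<close>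

text \<open>The expansion of 1/(1 - X)^(n+1), stated without division so that it makes sense over
  \<open>int\<close>. Multiplication by \<open>1 - fps_X\<close> takes differences of consecutive
  coefficients, and by Pascal's rule this lowers \<open>Suc n\<close> to \<open>n\<close>.\<close>

lemma fps_binomial_mult_one_minus_X_power:
  "Abs_fps (\<lambda>k. of_nat ((n + k) choose n)) * (1 - fps_X) ^ (n + 1) = (1 :: 'a :: comm_ring_1 fps)"
proof (induction n)
  case 0
  have "Abs_fps (\<lambda>k. 1) * (1 - fps_X) = (1 :: 'a fps)"
    by (rule fps_ext) (simp add: right_diff_distrib)
  then show ?case by simp
next
  case (Suc n)
  let ?G = "\<lambda>n. Abs_fps (\<lambda>k. of_nat ((n + k) choose n)) :: 'a fps"
  have "?G (Suc n) * (1 - fps_X) = ?G n"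
  proof (rule fps_ext)
    fix k
    show "fps_nth (?G (Suc n) * (1 - fps_X)) k = fps_nth (?G n) k"
      by (cases k) (simp_all add: right_diff_distrib binomial_eq_0)
  qed
  then have "?G (Suc n) * (1 - fps_X) ^ (Suc n + 1) = ?G n * (1 - fps_X) ^ (n + 1)"
    by (simp add: mult.assoc[symmetric])
  with Suc.IH show ?case by simp
qed

text \<open>The base is (1 - X^e)/(1 - X). Each term of the binomial expansion of (1 - X^e)^(n+1)
  shifts the series of 1/(1 - X)^(n+1) by \<open>m * e\<close>. Since \<open>m * e \<le> k\<close>
  on the summation range, the natural subtraction is exact.\<close>

lemma coeff_geometric_power:
  fixes n e k :: nat
  assumes "e > 0"
  shows "coeff ((\<Sum>j<e. monom (1 :: int) j) ^ (n + 1)) k =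
    (\<Sum>m = 0..k div e. (-1) ^ m * int ((n + 1) choose m) * int ((n + k - m * e) choose n))"
    (is "coeff ?F k = (\<Sum>m = 0..k div e. ?t m)")
proof -
  let ?G = "Abs_fps (\<lambda>k. int ((n + k) choose n))"
  define S where "S = (\<Sum>j<e. (fps_X :: int fps) ^ j)"
  have F: "fps_of_poly ?F = S ^ (n + 1)"
    by (simp only: S_def fps_of_poly_power fps_of_poly_sum fps_of_poly_monom')
  have "S ^ (n + 1) = ?G * ((1 - fps_X) * S) ^ (n + 1)"
    using fps_binomial_mult_one_minus_X_power[of n, where 'a = int]
    by (simp only: power_mult_distrib mult.assoc[symmetric] of_nat_id int_nat_eq) simp
  \<comment> \<open>With the summands in this order, the index \<open>m\<close> of
    \<open>binomial_ring\<close> counts the factors \<open>- (fps_X ^ e)\<close>.\<close>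
  also have "(1 - fps_X) * S = - (fps_X ^ e) + 1"
    by (simp add: S_def one_diff_power_eq)
  also have "(- (fps_X ^ e) + 1 :: int fps) ^ (n + 1) =
      (\<Sum>m\<le>n + 1. fps_const ((-1) ^ m * int ((n + 1) choose m)) * fps_X ^ (m * e))"
    unfolding binomial_ring
    by (rule sum.cong)
      (simp_all add: power_minus[of "_ ^ _"] power_mult[symmetric] mult.commute
         fps_of_nat[symmetric] fps_const_power[symmetric] fps_const_mult[symmetric]
         fps_const_neg[symmetric] del: fps_const_power fps_const_mult fps_const_neg)
  finally have "fps_of_poly ?F =
      (\<Sum>m\<le>n + 1. fps_const ((-1) ^ m * int ((n + 1) choose m)) * (fps_X ^ (m * e) * ?G))"
    by (simp only: F sum_distrib_left mult_ac)
  then have "coeff ?F k = (\<Sum>m\<le>n + 1. if m * e \<le> k then ?t m else 0)"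
    unfolding fps_of_poly_nth[symmetric]
    by (simp only: fps_sum_nth fps_mult_left_const_nth fps_X_power_mult_nth fps_nth_Abs_fps)
      (rule sum.cong, auto simp: not_less)
  also have "\<dots> = sum ?t {m. m \<le> n + 1 \<and> m * e \<le> k}"
    by (simp only: sum.If_cases[OF finite_atMost] sum.neutral_const add_0_right Int_def mem_Collect_eq atMost_iff)
  \<comment> \<open>For \<open>e > 0\<close>, \<open>m * e \<le> k\<close> means
    \<open>m \<le> k div e\<close>. Indices beyond \<open>n + 1\<close> may be added because
    \<open>(n + 1) choose m\<close> vanishes there.\<close>
  also have "\<dots> = (\<Sum>m = 0..k div e. ?t m)"
    using assms by (intro sum.mono_neutral_left) (auto simp: less_eq_div_iff_mult_less_eq)
  finally show ?thesis .
qed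

lemma degree_geometric_power:
  assumes "e > 0"
  shows "Polynomial.degree ((\<Sum>j<e. monom (1 :: int) j) ^ m) = m * (e - 1)"
proof -
  let ?p = "\<Sum>j<e. monom (1 :: int) j"
  have c: "coeff ?p i = (if i < e then 1 else 0)" for i
    by (simp add: coeff_sum)
  have "Polynomial.degree ?p = e - 1"
    using assms by (intro order.antisym degree_le le_degree) (auto simp: c)
  moreover have "?p \<noteq> 0"
    using assms c[of 0] by auto
  ultimately show ?thesis
    by (simp add: degree_power_eq)
qed

section \<open>Standard monomials\<close>

text \<open>Distributing the product over the sums selects one exponent below \<open>e\<close> from
  each of the \<open>n + 1\<close> factors. A selection contributes 1 to the coefficient exactly
  when its exponents add up to \<open>k\<close>.\<close>

lemma coeff_geometric_power_card:
  "coeff ((\<Sum>j<e. monom (1 :: int) j) ^ (n + 1)) k =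
    int (card {g \<in> {..n} \<rightarrow>\<^sub>E {..<e}. sum g {..n} = k})"
proof -
  have prod_monom: "(\<Prod>i\<in>A. monom (1 :: int) (g i)) = monom 1 (sum g A)" if "finite A"
    for g :: "nat \<Rightarrow> nat" and A
    using that by (induction A rule: finite_induct) (simp_all add: mult_monom)
  have "(\<Sum>j<e. monom (1 :: int) j) ^ (n + 1) = (\<Prod>i\<le>n. \<Sum>j<e. monom 1 j)"
    by simp
  also have "\<dots> = (\<Sum>g\<in>{..n} \<rightarrow>\<^sub>E {..<e}. monom 1 (sum g {..n}))"
    by (subst prod_sum_PiE) (simp_all add: prod_monom)
  finally show ?thesis
    by (simp add: coeff_sum sum.If_cases finite_PiE Int_def)
qed

text \<open>In degree \<open>k\<close>, these are the monomials outside the ideal generated by the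
  powers x_i^e. They are used with \<open>e = d - 1\<close>.\<close>

definition standard_monomials :: "nat \<Rightarrow> nat \<Rightarrow> nat \<Rightarrow> monomial set" where
  "standard_monomials n e k =
     {m. Poly_Mapping.keys m \<subseteq> {..n} \<and> (\<forall>i\<le>n. Poly_Mapping.lookup m i < e) \<and>
         total_degree m = k}"

text \<open>A monomial corresponds to its exponent vector. Outside \<open>{..n}\<close> a monomial
  has value 0 while an extensional function is \<open>undefined\<close>, which is why one direction
  restricts and the other fills in zeros.\<close>

lemma bij_betw_standard_monomials:
  "bij_betw (\<lambda>m. restrict (Poly_Mapping.lookup m) {..n}) (standard_monomials n e k)
     {g \<in> {..n} \<rightarrow>\<^sub>E {..<e}. sum g {..n} = k}"
proof (rule bij_betw_byWitness[where
    f' = "\<lambda>g. Abs_poly_mapping (\<lambda>i. if i \<le> n then g i else 0)"])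
  have lookup_Abs: "Poly_Mapping.lookup (Abs_poly_mapping (\<lambda>i. if i \<le> n then g i else 0)) =
      (\<lambda>i. if i \<le> n then g i else 0)" for g :: "nat \<Rightarrow> nat"
    by (rule lookup_Abs_poly_mapping) (rule finite_subset[of _ "{..n}"], auto)
  have degree: "total_degree m = (\<Sum>i\<le>n. Poly_Mapping.lookup m i)"
    if "Poly_Mapping.keys m \<subseteq> {..n}" for m
    unfolding total_degree_def using that
    by (intro sum.mono_neutral_left) (auto simp: in_keys_iff)
  show "\<forall>m\<in>standard_monomials n e k. Abs_poly_mapping
      (\<lambda>i. if i \<le> n then restrict (Poly_Mapping.lookup m) {..n} i else 0) = m"
    by (auto simp: standard_monomials_def poly_mapping_eq_iff lookup_Abs fun_eq_iff in_keys_iff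
        subset_iff)
  show "\<forall>g\<in>{g \<in> {..n} \<rightarrow>\<^sub>E {..<e}. sum g {..n} = k}.
      restrict (Poly_Mapping.lookup (Abs_poly_mapping (\<lambda>i. if i \<le> n then g i else 0))) {..n} = g"
    by (auto simp: lookup_Abs fun_eq_iff PiE_def extensional_def)
  show "(\<lambda>m. restrict (Poly_Mapping.lookup m) {..n}) ` standard_monomials n e k
      \<subseteq> {g \<in> {..n} \<rightarrow>\<^sub>E {..<e}. sum g {..n} = k}"
    by (auto simp: standard_monomials_def degree split: if_splits)
  show "(\<lambda>g. Abs_poly_mapping (\<lambda>i. if i \<le> n then g i else 0)) `
      {g \<in> {..n} \<rightarrow>\<^sub>E {..<e}. sum g {..n} = k} \<subseteq> standard_monomials n e k"
  proof (rule image_subsetI)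
    fix g assume g: "g \<in> {g \<in> {..n} \<rightarrow>\<^sub>E {..<e}. sum g {..n} = k}"
    let ?m = "Abs_poly_mapping (\<lambda>i. if i \<le> n then g i else 0)"
    have "Poly_Mapping.keys ?m \<subseteq> {..n}"
      by (auto simp: in_keys_iff lookup_Abs split: if_splits)
    with g show "?m \<in> standard_monomials n e k"
      by (auto simp: standard_monomials_def degree lookup_Abs)
  qed
qed

lemma finite_standard_monomials: "finite (standard_monomials n e k)"
  unfolding bij_betw_finite[OF bij_betw_standard_monomials] by (simp add: finite_PiE)

lemma card_standard_monomials:
  "int (card (standard_monomials n e k)) = coeff ((\<Sum>j<e. monom (1 :: int) j) ^ (n + 1)) k"
  by (simp only: coeff_geometric_power_card bij_betw_same_card[OF bij_betw_standard_monomials])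

section \<open>Dimensions in the polynomial ring\<close>

lemma poly_ring_simps [simp]:
  "p \<oplus>\<^bsub>poly_ring n\<^esub> q = p + q" "p \<otimes>\<^bsub>poly_ring n\<^esub> q = p * q"
  "\<zero>\<^bsub>poly_ring n\<^esub> = 0" "\<one>\<^bsub>poly_ring n\<^esub> = 1"
  by (simp_all add: poly_ring_def)

lemma poly_ring_minus:
  assumes "p \<in> carrier (poly_ring n)" "q \<in> carrier (poly_ring n)"
  shows "p \<ominus>\<^bsub>poly_ring n\<^esub> q = p - q"
proof -
  interpret cring "poly_ring n" by (rule cring_poly_ring)
  have "- q \<in> carrier (poly_ring n)"
    using assms by (simp add: poly_ring_def)
  with assms have "\<ominus>\<^bsub>poly_ring n\<^esub> q = - q"
    by (intro minus_equality) simp_all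
  then show ?thesis by (simp add: a_minus_def)
qed

lemma poly_mapping_sum_single:
  "(p :: 'a \<Rightarrow>\<^sub>0 'b :: comm_monoid_add) =
     (\<Sum>m\<in>Poly_Mapping.keys p. Poly_Mapping.single m (Poly_Mapping.lookup p m))"
  by (rule poly_mapping_eqI) (auto simp: lookup_sum lookup_single when_def in_keys_iff)

lemma Const_carrier [simp]: "Const c \<in> carrier (poly_ring n)"
  by (simp add: Const_def poly_ring_def)

lemma Const_mult_single: "Const c * Poly_Mapping.single m a = Poly_Mapping.single m (c * a)"
  by (simp add: Const_def mult_single)

text \<open>The constants are a copy of the complex numbers inside the ring; they serve as scalars
  for \<open>dimension\<close>, and inverses come from the coefficient field.\<close>

lemma subfield_range_Const: "subfield (range Const) (poly_ring n)"
proof -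
  interpret cring "poly_ring n" by (rule cring_poly_ring)
  have arith: "Const a + Const b = Const (a + b)" "Const a * Const b = Const (a * b)"
    "1 = Const 1" "0 = Const 0" for a b
    by (simp_all add: Const_def single_add mult_single)
  have inj: "Const a = Const b \<longleftrightarrow> a = b" for a b
    by (auto simp: Const_def dest: arg_cong[where f = "\<lambda>p. Poly_Mapping.lookup p 0"])
  have neg: "\<ominus>\<^bsub>poly_ring n\<^esub> Const a = Const (- a)" for a
    by (rule minus_equality) (simp_all add: arith)
  show ?thesis
  proof (rule subfieldI)
    show "subcring (range Const) (poly_ring n)"
      by (rule subcringI', rule subringI) (auto simp: arith neg)
    show "Units (poly_ring n\<lparr>carrier := range Const\<rparr>) = range Const - {\<zero>\<^bsub>poly_ring n\<^esub>}"
    proof (intro equalityI subsetI)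
      fix x assume "x \<in> Units (poly_ring n\<lparr>carrier := range Const\<rparr>)"
      then show "x \<in> range Const - {\<zero>\<^bsub>poly_ring n\<^esub>}"
        by (auto simp: Units_def)
    next
      fix x assume "x \<in> range Const - {\<zero>\<^bsub>poly_ring n\<^esub>}"
      then obtain c where c: "x = Const c" "c \<noteq> 0"
        by (auto simp: arith)
      then have "Const (inverse c) * x = 1" "x * Const (inverse c) = 1"
        by (simp_all add: arith(2)) (simp_all add: arith(3))
      with c show "x \<in> Units (poly_ring n\<lparr>carrier := range Const\<rparr>)"
        by (auto simp: Units_def)
    qed
  qed
qed

text \<open>Monomials are linearly independent: a monomial outside \<open>B\<close> is not in the
  span of \<open>B\<close>, so adjoining it is a line extension that raises the dimension by
  one.\<close>

lemma dimension_supported_polynomials: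
  assumes "finite B" "\<And>m. m \<in> B \<Longrightarrow> Poly_Mapping.keys m \<subseteq> {..n}"
  shows "ring.dimension (poly_ring n) (card B) (range Const) {p. Poly_Mapping.keys p \<subseteq> B}"
  using assms
proof (induction B rule: finite_induct)
  interpret cring "poly_ring n" by (rule cring_poly_ring)
  case empty
  show ?case using zero_dim[of "range Const"] by simp
next
  interpret cring "poly_ring n" by (rule cring_poly_ring)
  case (insert m B)
  let ?x = "Poly_Mapping.single m (1 :: complex)"
  let ?E = "\<lambda>B. {p :: cpoly. Poly_Mapping.keys p \<subseteq> B}"
  have "line_extension (range Const) ?x (?E B) = ?E (insert m B)"
  proof (intro equalityI subsetI)
    fix p assume "p \<in> line_extension (range Const) ?x (?E B)"
    then obtain c q where p: "p = Poly_Mapping.single m c + q" and q: "Poly_Mapping.keys q \<subseteq> B"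
      by (auto simp: line_extension_mem_iff Const_mult_single)
    have "Poly_Mapping.keys p \<subseteq> Poly_Mapping.keys (Poly_Mapping.single m c) \<union> Poly_Mapping.keys q"
      unfolding p by (rule Poly_Mapping.keys_add)
    with q show "p \<in> ?E (insert m B)" by (auto split: if_splits)
  next
    fix p assume p: "p \<in> ?E (insert m B)"
    \<comment> \<open>Splitting off the term of \<open>p\<close> at \<open>m\<close> leaves a
      remainder supported on \<open>B\<close>.\<close>
    let ?c = "Poly_Mapping.lookup p m"
    let ?q = "p - Poly_Mapping.single m ?c"
    have "Poly_Mapping.keys ?q \<subseteq> B"
      using p by (auto simp: in_keys_iff lookup_minus lookup_single when_def split: if_splits)
    moreover have "p = Const ?c * ?x + ?q"
      by (simp add: Const_mult_single)
    ultimately show "p \<in> line_extension (range Const) ?x (?E B)"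
      unfolding line_extension_mem_iff poly_ring_simps by blast
  qed
  moreover have "?x \<in> carrier (poly_ring n)"
    using insert.prems by (simp add: poly_ring_def)
  moreover have "?x \<notin> ?E B"
    using insert.hyps by simp
  ultimately show ?case
    using Suc_dim[of ?x "?E B" "card B" "range Const"] insert by simp
qed

section \<open>The Jacobian ideal of the Fermat polynomial\<close>

lemma Var_power: "Var i ^ d = Poly_Mapping.single (Poly_Mapping.single i d) 1"
  by (induction d) (simp_all add: Var_def mult_single single_add[symmetric])

definition fermat :: "nat \<Rightarrow> nat \<Rightarrow> cpoly" where
  "fermat n d = (\<Sum>i\<le>n. Var i ^ d)"

text \<open>Keeps the \<open>n + 1\<close> terms of the Fermat polynomial distinct. For
  \<open>d = 0\<close> all of these monomials would coincide with the empty one.\<close>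

lemma single_eq_single_iff:
  "d \<noteq> 0 \<Longrightarrow> Poly_Mapping.single i d = Poly_Mapping.single j d \<longleftrightarrow> i = j"
  by (auto simp: poly_mapping_eq_iff fun_eq_iff lookup_single when_def split: if_splits)

lemma lookup_fermat:
  "Poly_Mapping.lookup (fermat n d) m = (\<Sum>i\<le>n. 1 when Poly_Mapping.single i d = m)"
  by (simp add: fermat_def Var_power lookup_sum lookup_single)

lemma lookup_fermat_single:
  assumes "d \<noteq> 0" "i \<le> n"
  shows "Poly_Mapping.lookup (fermat n d) (Poly_Mapping.single i d) = 1"
  using assms by (simp add: lookup_fermat single_eq_single_iff when_def)

lemma keys_fermat:
  assumes "d \<noteq> 0"
  shows "Poly_Mapping.keys (fermat n d) = (\<lambda>i. Poly_Mapping.single i d) ` {..n}"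
proof (intro equalityI subsetI)
  fix m assume "m \<in> Poly_Mapping.keys (fermat n d)"
  then have "(\<Sum>i\<le>n. (1 :: complex) when Poly_Mapping.single i d = m) \<noteq> 0"
    by (simp add: in_keys_iff lookup_fermat)
  then obtain i where "i \<le> n" "((1 :: complex) when Poly_Mapping.single i d = m) \<noteq> 0"
    by (rule sum.not_neutral_contains_not_neutral) auto
  then show "m \<in> (\<lambda>i. Poly_Mapping.single i d) ` {..n}" by (auto simp: when_def split: if_splits)
qed (auto simp: in_keys_iff lookup_fermat_single[OF assms])

lemma fermat_carrier: "d \<noteq> 0 \<Longrightarrow> fermat n d \<in> carrier (poly_ring n)"
  by (auto simp: poly_ring_def keys_fermat)

lemma partial_deriv_fermat:
  assumes "d \<noteq> 0" "i \<le> n"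
  shows "partial_deriv i (fermat n d) = Poly_Mapping.single (Poly_Mapping.single i (d - 1)) (of_nat d)"
proof -
  have "inj_on (\<lambda>i. Poly_Mapping.single i d) {..n}"
    using assms by (simp add: inj_on_def single_eq_single_iff)
  then have "partial_deriv i (fermat n d) =
      (\<Sum>j\<le>n. Poly_Mapping.single (Poly_Mapping.single j d - Poly_Mapping.single i 1)
        (of_nat (Poly_Mapping.lookup (Poly_Mapping.single j d) i)))"
    unfolding partial_deriv_def keys_fermat[OF assms(1)]
    by (simp add: sum.reindex lookup_fermat_single assms)
  \<comment> \<open>For \<open>j \<noteq> i\<close> the exponent of x_i in x_j^d is 0, so the
    coefficient kills the term whatever the truncated exponent is.\<close>
  also have "\<dots> = (\<Sum>j\<le>n. if j = i
      then Poly_Mapping.single (Poly_Mapping.single i (d - 1)) (of_nat d) else 0)"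
    by (rule sum.cong) (auto simp: lookup_single when_def single_diff[symmetric])
  finally show ?thesis
    using assms by simp
qed

text \<open>Every monomial of a product \<open>x * p\<close> is divisible by a monomial of
  \<open>p\<close>, so a large exponent persists; sums and negatives introduce no new
  monomials.\<close>

lemma ideal_monomials_exceeding:
  "ideal {p \<in> carrier (poly_ring n). \<forall>m\<in>Poly_Mapping.keys p. \<exists>i\<le>n. e \<le> Poly_Mapping.lookup m i}
     (poly_ring n)" (is "ideal ?J _")
proof -
  interpret cring "poly_ring n" by (rule cring_poly_ring)
  have mult: "x * p \<in> ?J" if p: "p \<in> ?J" and x: "x \<in> carrier (poly_ring n)" for p x
  proof -
    have "\<exists>i\<le>n. e \<le> Poly_Mapping.lookup m i" if m: "m \<in> Poly_Mapping.keys (x * p)" for m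
    proof -
      obtain a b where "m = a + b" "b \<in> Poly_Mapping.keys p"
        using subsetD[OF keys_mult m] by blast
      with p obtain i where "i \<le> n" "e \<le> Poly_Mapping.lookup b i" by blast
      with \<open>m = a + b\<close> show ?thesis by (auto simp: lookup_add intro: trans_le_add2)
    qed
    moreover have "x * p \<in> carrier (poly_ring n)"
      using m_closed[of x p] p x by simp
    ultimately show ?thesis by simp
  qed
  show ?thesis
  proof (rule idealI)
    show "subgroup ?J (add_monoid (poly_ring n))"
    proof (rule add.subgroupI)
      show "?J \<noteq> {}" using zero_closed by auto
      fix p q assume p: "p \<in> ?J"
      have "\<ominus>\<^bsub>poly_ring n\<^esub> p = - p"
        using p poly_ring_minus[of 0 n p] zero_closed by (simp add: a_minus_def)
      moreover have "- p \<in> carrier (poly_ring n)"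
        using p by (simp add: poly_ring_def)
      ultimately show "\<ominus>\<^bsub>poly_ring n\<^esub> p \<in> ?J"
        using p by simp
      assume q: "q \<in> ?J"
      then have "p + q \<in> carrier (poly_ring n)"
        using p a_closed[of p q] by simp
      then show "p \<oplus>\<^bsub>poly_ring n\<^esub> q \<in> ?J"
        using p q Poly_Mapping.keys_add[of p q] by auto
    qed auto
  qed (use mult ring_axioms in \<open>simp_all add: mult.commute\<close>)
qed

text \<open>One inclusion is minimality of the generated ideal. For the other, each term of a
  polynomial on the right is a multiple of some generator \<open>d\<close> x_i^(d-1), as
  \<open>d\<close> is invertible in the coefficient field.\<close>

lemma jacobian_ideal_fermat:
  assumes "d \<noteq> 0"
  shows "jacobian_ideal n (fermat n d) =
    {p \<in> carrier (poly_ring n).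
       \<forall>m\<in>Poly_Mapping.keys p. \<exists>i\<le>n. d - 1 \<le> Poly_Mapping.lookup m i}" (is "?I = ?J")
proof
  interpret cring "poly_ring n" by (rule cring_poly_ring)
  let ?gens = "(\<lambda>i. partial_deriv i (fermat n d)) ` {..n}"
  have gens: "?gens \<subseteq> carrier (poly_ring n)"
    using partial_deriv_closed[OF fermat_carrier[OF assms]] by (rule image_subsetI)
  show "?I \<subseteq> ?J"
    unfolding jacobian_ideal_def
  proof (rule genideal_minimal[OF ideal_monomials_exceeding], rule subsetI)
    fix p assume "p \<in> ?gens"
    with gens show "p \<in> ?J"
      by (auto simp: partial_deriv_fermat[OF assms] split: if_splits)
  qed
  interpret I: ideal ?I "poly_ring n"
    by (rule ideal_jacobian_ideal[OF fermat_carrier[OF assms]])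
  show "?J \<subseteq> ?I"
  proof
    fix p assume p: "p \<in> ?J"
    have single: "Poly_Mapping.single m c \<in> ?I" if m: "m \<in> Poly_Mapping.keys p" for m c
    proof -
      obtain i where i: "i \<le> n" "d - 1 \<le> Poly_Mapping.lookup m i"
        using p m by blast
      \<comment> \<open>The quotient of \<open>m\<close> by x_i^(d-1); the truncated subtraction is
        exact because the exponent of x_i in \<open>m\<close> is at least
        \<open>d - 1\<close>.\<close>
      let ?r = "m - Poly_Mapping.single i (d - 1)"
      have "m = ?r + Poly_Mapping.single i (d - 1)"
        using i by (intro poly_mapping_eqI) (auto simp: lookup_add lookup_minus lookup_single when_def)
      then have "Poly_Mapping.single m c =
          Poly_Mapping.single ?r (c / of_nat d) * partial_deriv i (fermat n d)"
        using assms i by (simp add: partial_deriv_fermat mult_single)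
      moreover have "Poly_Mapping.single ?r (c / of_nat d) \<in> carrier (poly_ring n)"
        using p m by (auto simp: poly_ring_def in_keys_iff lookup_minus subset_iff)
      moreover have "partial_deriv i (fermat n d) \<in> ?I"
        unfolding jacobian_ideal_def using genideal_self[OF gens] i by blast
      ultimately show ?thesis
        using I.I_l_closed by simp
    qed
    \<comment> \<open>The sum of all terms of \<open>p\<close> is built up over finite subsets of
      its support, using closure of the ideal under addition.\<close>
    have "(\<Sum>m\<in>A. Poly_Mapping.single m (Poly_Mapping.lookup p m)) \<in> ?I"
      if "finite A" "A \<subseteq> Poly_Mapping.keys p" for A
      using that
    proof (induction A rule: finite_induct)
      case empty
      then show ?case using I.zero_closed by simp
    next
      case (insert m A)
      then show ?case using I.a_closed[OF single] by simp
    qed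
    from this[of "Poly_Mapping.keys p"] show "p \<in> ?I"
      by (simp flip: poly_mapping_sum_single)
  qed
qed

text \<open>The quotient map sends the span of the standard monomials of degree \<open>k\<close>
  bijectively onto the component of degree \<open>k\<close>, and such a bijection preserves
  dimension.\<close>

lemma dim_milnor_component_fermat:
  assumes "d \<ge> 2"
  shows "(ring.dim (milnor_algebra n (fermat n d)) over milnor_scalars n (fermat n d))
      (milnor_component n (fermat n d) k) = card (standard_monomials n (d - 1) k)"
proof -
  let ?f = "fermat n d" and ?B = "standard_monomials n (d - 1) k"
  let ?E = "{p :: cpoly. Poly_Mapping.keys p \<subseteq> ?B}" and ?h = "milnor_class n (fermat n d)"
  have d: "d \<noteq> 0" using assms by simp
  interpret R: cring "poly_ring n" by (rule cring_poly_ring)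
  interpret I: ideal "jacobian_ideal n ?f" "poly_ring n"
    by (rule ideal_jacobian_ideal[OF fermat_carrier[OF d]])
  have h: "?h = (+>\<^bsub>poly_ring n\<^esub>) (jacobian_ideal n ?f)"
    by (simp add: milnor_class_def fun_eq_iff)
  interpret H: ring_hom_ring "poly_ring n" "milnor_algebra n ?f" ?h
    unfolding h milnor_algebra_def by (rule I.rcos_ring_hom_ring)
  have same_class: "?h p = ?h q \<longleftrightarrow> p - q \<in> jacobian_ideal n ?f"
    if "p \<in> carrier (poly_ring n)" "q \<in> carrier (poly_ring n)" for p q
    using R.quotient_eq_iff_same_a_r_cos[OF I.is_ideal that] poly_ring_minus[OF that] h by simp
  have E_hom: "?E \<subseteq> homogeneous_part n k"
    by (auto simp: homogeneous_part_def poly_ring_def standard_monomials_def)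
  then have E_carrier: "?E \<subseteq> carrier (poly_ring n)"
    by (auto simp: homogeneous_part_def)
  have inj: "inj_on ?h ?E"
  proof (rule inj_onI)
    fix p q assume p: "p \<in> ?E" and q: "q \<in> ?E" and "?h p = ?h q"
    then have "p - q \<in> jacobian_ideal n ?f"
      using same_class E_carrier by blast
    moreover have "Poly_Mapping.keys (p - q) \<subseteq> ?B"
      using p q keys_diff[of p q] by blast
    \<comment> \<open>A monomial of \<open>p - q\<close> would have all exponents below
      \<open>d - 1\<close>, being standard, and some exponent at least \<open>d - 1\<close>, by
      membership in the ideal.\<close>
    ultimately have "Poly_Mapping.keys (p - q) = {}"
      unfolding jacobian_ideal_fermat[OF d] standard_monomials_def by fastforce
    then show "p = q" by simp
  qed
  have image: "?h ` ?E = milnor_component n ?f k"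
  proof
    show "?h ` ?E \<subseteq> milnor_component n ?f k"
      unfolding milnor_component_def using E_hom by (rule image_mono)
    show "milnor_component n ?f k \<subseteq> ?h ` ?E"
      unfolding milnor_component_def
    proof (rule image_subsetI)
      fix p assume p: "p \<in> homogeneous_part n k"
      \<comment> \<open>The standard part of \<open>p\<close>. What remains in \<open>p - q\<close>
        are nonstandard monomials of degree \<open>k\<close>, all of which lie in the ideal.\<close>
      define q where "q = Poly_Mapping.mapp (\<lambda>m c. c when m \<in> ?B) p"
      have lookup_q: "Poly_Mapping.lookup q m = (Poly_Mapping.lookup p m when m \<in> ?B)" for m
        by (auto simp: q_def lookup_mapp when_def in_keys_iff)
      have q: "q \<in> ?E"
        by (auto simp: in_keys_iff lookup_q)
      have pc: "p \<in> carrier (poly_ring n)"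
        using p by (simp add: homogeneous_part_def)
      have "m \<in> Poly_Mapping.keys p - ?B" if "m \<in> Poly_Mapping.keys (p - q)" for m
        using that by (auto simp: in_keys_iff lookup_minus lookup_q when_def split: if_splits)
      moreover have "Poly_Mapping.keys m \<subseteq> {..n} \<and> total_degree m = k"
        if "m \<in> Poly_Mapping.keys p" for m
        using that p by (auto simp: homogeneous_part_def poly_ring_def)
      ultimately have "p - q \<in> jacobian_ideal n ?f"
        unfolding jacobian_ideal_fermat[OF d]
        by (force simp: poly_ring_def standard_monomials_def not_less)
      then have "?h p = ?h q"
        using same_class pc q E_carrier by blast
      with q show "?h p \<in> ?h ` ?E" by blast
    qed
  qed
  have scalars: "?h ` range Const = milnor_scalars n ?f"
    by (simp add: milnor_scalars_def image_image)
  \<comment> \<open>Here \<open>d \<ge> 2\<close> enters: the monomial 1 has only zero exponents, so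
    it avoids the ideal. A nontrivial quotient makes the image of the constants a field.\<close>
  have one_zero: "\<one>\<^bsub>milnor_algebra n ?f\<^esub> \<noteq> \<zero>\<^bsub>milnor_algebra n ?f\<^esub>"
  proof
    assume "\<one>\<^bsub>milnor_algebra n ?f\<^esub> = \<zero>\<^bsub>milnor_algebra n ?f\<^esub>"
    then have "?h 1 = ?h 0"
      using H.hom_one H.hom_zero by simp
    then have "1 \<in> jacobian_ideal n ?f"
      using same_class[of 1 0] R.one_closed R.zero_closed by simp
    then obtain i where "i \<le> n" "d - 1 \<le> Poly_Mapping.lookup (0 :: monomial) i"
      unfolding jacobian_ideal_fermat[OF d] by auto
    then show False
      using assms by simp
  qed
  have "R.dimension (card ?B) (range Const) ?E"
    by (rule dimension_supported_polynomials)
      (auto simp: finite_standard_monomials, auto simp: standard_monomials_def)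
  \<comment> \<open>The quotient map has a kernel, but injectivity on \<open>?E\<close> suffices to
    transport its dimension.\<close>
  from H.inj_hom_dimension[OF subfield_range_Const one_zero inj this]
  have "H.S.dimension (card ?B) (milnor_scalars n ?f) (milnor_component n ?f k)"
    unfolding image scalars .
  moreover have "subfield (milnor_scalars n ?f) (milnor_algebra n ?f)"
    using H.img_is_subfield(2)[OF subfield_range_Const one_zero] unfolding scalars .
  ultimately show ?thesis
    by (intro H.S.dimI)
qed

theorem proposition2p6:
  fixes n d :: nat
  assumes "n \<ge> 1" and "d \<ge> 2"
  defines "f \<equiv> (\<Sum>i\<le>n. Var i ^ d)"
    and "T \<equiv> (n + 1) * (d - 2)"
    and "F \<equiv> (\<Sum>j\<le>d - 2. monom (1::int) j) ^ (n + 1)"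
  defines "a \<equiv> fps_nth (milnor_HP n f)"
  shows "milnor_HP n f = fps_of_poly F \<and> Polynomial.degree F = T \<and>
    (\<forall>k. k \<le> d - 2 \<longrightarrow> a k = int ((n + k) choose n)) \<and>
    (\<forall>k. k \<ge> d - 1 \<longrightarrow>
       a k = int ((n + k) choose n) +
         (\<Sum>m = 1..k div (d - 1).
            (-1) ^ m * int ((n + 1) choose m) * int ((n + k - m * (d - 1)) choose n)))"
proof -
  have e: "0 < d - 1" using \<open>d \<ge> 2\<close> by simp
  \<comment> \<open>Sets \<open>e = d - 1\<close> in the general results; \<open>d \<ge> 2\<close>
    excludes truncation in \<open>d - 2\<close>.\<close>
  have "{..d - 2} = {..<d - 1}" using \<open>d \<ge> 2\<close> by auto
  then have F: "F = (\<Sum>j<d - 1. monom 1 j) ^ (n + 1)"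
    by (simp only: F_def)
  have HP: "milnor_HP n f = fps_of_poly F"
    unfolding milnor_HP_def F f_def fermat_def[symmetric] dim_milnor_component_fermat[OF \<open>d \<ge> 2\<close>]
      card_standard_monomials by (rule fps_ext) simp
  have "Polynomial.degree F = (n + 1) * (d - 1 - 1)"
    unfolding F by (rule degree_geometric_power[OF e])
  then have deg: "Polynomial.degree F = T"
    by (simp only: T_def diff_diff_left one_add_one)
  \<comment> \<open>The formula of (b) holds for every \<open>k\<close>; the leading binomial is the
    term \<open>m = 0\<close>.\<close>
  have a: "a k = int ((n + k) choose n) + (\<Sum>m = 1..k div (d - 1).
      (-1) ^ m * int ((n + 1) choose m) * int ((n + k - m * (d - 1)) choose n))" for k
    unfolding a_def HP fps_of_poly_nth F coeff_geometric_power[OF e]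
    by (subst sum.atLeast_Suc_atMost) simp_all
  have "a k = int ((n + k) choose n)" if "k \<le> d - 2" for k
  proof -
    \<comment> \<open>Part (a) is the case in which the correction sum is empty.\<close>
    have "k div (d - 1) = 0" using that e by simp
    then show ?thesis by (simp add: a)
  qed
  with HP deg a show ?thesis by blast
qed

end
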